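(* Let $m\ge 2$ and let $\tilde\mu$ be the probability $(\mu_1\times\mu_2)\circ F^{-1}$ on the two-sided $m$-Dyck shift $X$. Then $\tilde\mu$ is a shift invariant probability.
   Context: Let $\Sigma=\{\alpha_1,\ldots,\alpha_m\}\cup\{\beta_1,\ldots,\beta_m\}$. The Dyck monoid $M$ is the monoid with zero $0$ and identity $1$ (the empty word), generated by $\alpha_i,\beta_i$ ($1\le i\le m$) with relations $\alpha_j\beta_j\equiv 1$ and $\alpha_i\beta_j\equiv 0$ for $i\ne j$. Let $L=\{l\in\Sigma^*: l\not\equiv 0 \text{ (mod } M)\}$ and $X=\{x\in\Sigma^{\mathbb Z}: x_r\cdots x_l\in L \text{ for all } r\le l\}$ (the two-sided $m$-Dyck shift), with shift map $(Tx)_n=x_{n+1}$. For $z\in\{0,1\}^{\mathbb Z}$ put $\tilde H_0(z)=0$, $\tilde H_i(z)=\sum_{j=0}^{i-1}(\delta_{1,z_j}-\delta_{0,z_j})$ for $i>0$ and $\tilde H_i(z)=\sum_{j=i}^{-1}(\delta_{0,z_j}-\delta_{1,z_j})$ for $i<0$. Let $S_{-\infty}^{-\infty}=\{z\in\{0,1\}^{\mathbb Z}: \liminf_{n\to+\infty}\tilde H_n(z)=-\infty,\ \liminf_{n\to-\infty}\tilde H_n(z)=-\infty\}$. Define $\gamma_k(z)=\sum_{i=0}^k z_i$ for $k\ge 0$, $\gamma_k(z)=-\sum_{i=k}^{-1}z_i$ for $k<0$, and $\varepsilon_n(z)=\max\{l<n: \tilde H_l(z)\le\tilde H_{n+1}(z)\}$.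 Define the Borel function $F:S_{-\infty}^{-\infty}\times\{1,\ldots,m\}^{\mathbb Z}\to\Sigma^{\mathbb Z}$ by: $F(z,a)_n=\alpha_j$ if $z_n=1$ and $a_{\gamma_n(z)}=j$; $F(z,a)_n=\beta_j$ if $z_n=0$ and $a_{\gamma_k(z)}=j$ where $k=\varepsilon_n(z)$. $F$ takes values in $X$. Let $\mu_1$ and $\mu_2$ be the symmetric (uniform i.i.d.) product measures on $\{0,1\}^{\mathbb Z}$ and $\{1,\ldots,m\}^{\mathbb Z}$; then $\mu_1(S_{-\infty}^{-\infty})=1$, and $\tilde\mu=(\mu_1\times\mu_2)\circ F^{-1}$ is a Borel probability on $X$. Shift invariant means $\tilde\mu(T^{-1}A)=\tilde\mu(A)$ for all Borel $A\subset X$. *)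

theory Defs
  imports "HOL-Probability.Probability"
begin

datatype letter = Alpha nat | Beta nat

instantiation letter :: discrete_topology
begin

definition open_letter :: "letter set \<Rightarrow> bool"
  where "open_letter A \<longleftrightarrow> True"

instance
  by standard (simp_all add: open_letter_def)

end

definition alphabet :: "nat \<Rightarrow> letter set"
  where "alphabet m = Alpha ` {1..m} \<union> Beta ` {1..m}"

text \<open>The Dyck monoid is the quotient of the free monoid with zero over the alphabet by the
  congruence generated by the defining relations; \<^term>\<open>None\<close> is the zero and
  \<^term>\<open>Some []\<close> the identity.\<close>

definition words0 :: "nat \<Rightarrow> letter list option set"
  where "words0 m = insert None (Some ` lists (alphabet m))"

fun mult0 :: "letter list option \<Rightarrow> letter list option \<Rightarrow> letter list option"
  where
    "mult0 (Some u) (Some v) = Some (u @ v)"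
  | "mult0 _ _ = None"

inductive dyck_cong :: "nat \<Rightarrow> letter list option \<Rightarrow> letter list option \<Rightarrow> bool" for m
  where
    cancel: "j \<in> {1..m} \<Longrightarrow> dyck_cong m (Some [Alpha j, Beta j]) (Some [])"
  | clash: "i \<in> {1..m} \<Longrightarrow> j \<in> {1..m} \<Longrightarrow> i \<noteq> j \<Longrightarrow> dyck_cong m (Some [Alpha i, Beta j]) None"
  | refl: "u \<in> words0 m \<Longrightarrow> dyck_cong m u u"
  | sym: "dyck_cong m u v \<Longrightarrow> dyck_cong m v u"
  | trans: "dyck_cong m u v \<Longrightarrow> dyck_cong m v w \<Longrightarrow> dyck_cong m u w"
  | mult: "dyck_cong m u u' \<Longrightarrow> dyck_cong m v v' \<Longrightarrow> dyck_cong m (mult0 u v) (mult0 u' v')"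

definition dyck_language :: "nat \<Rightarrow> letter list set"
  where "dyck_language m = {l \<in> lists (alphabet m). \<not> dyck_cong m (Some l) None}"

definition dyck_shift :: "nat \<Rightarrow> (int \<Rightarrow> letter) set"
  where "dyck_shift m =
    {x \<in> UNIV \<rightarrow> alphabet m. \<forall>r l. r \<le> l \<longrightarrow> map x [r..l] \<in> dyck_language m}"

definition shift :: "(int \<Rightarrow> 'a) \<Rightarrow> int \<Rightarrow> 'a"
  where "shift x n = x (n + 1)"

definition height :: "(int \<Rightarrow> nat) \<Rightarrow> int \<Rightarrow> int"
  where "height z i =
    (if 0 \<le> i then \<Sum>j\<in>{0..<i}. of_bool (z j = 1) - of_bool (z j = 0)
     else \<Sum>j\<in>{i..-1}. of_bool (z j = 0) - of_bool (z j = 1))"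

definition S_minf_minf :: "(int \<Rightarrow> nat) set"
  where "S_minf_minf = {z \<in> UNIV \<rightarrow> {0, 1}.
    Liminf at_top (\<lambda>n. ereal (of_int (height z n))) = -\<infinity> \<and>
    Liminf at_bot (\<lambda>n. ereal (of_int (height z n))) = -\<infinity>}"

definition gamma_idx :: "(int \<Rightarrow> nat) \<Rightarrow> int \<Rightarrow> int"
  where "gamma_idx z k =
    (if 0 \<le> k then \<Sum>i\<in>{0..k}. int (z i) else - (\<Sum>i\<in>{k..-1}. int (z i)))"

text \<open>The set below is infinite, so its maximum is expressed by \<^const>\<open>Greatest\<close>, not by
  \<^const>\<open>Max\<close>. The maximum exists for \<open>z\<close> in \<^const>\<open>S_minf_minf\<close>.\<close>

definition eps_idx :: "(int \<Rightarrow> nat) \<Rightarrow> int \<Rightarrow> int"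
  where "eps_idx z n = (GREATEST l. l < n \<and> height z l \<le> height z (n + 1))"

definition F_map :: "(int \<Rightarrow> nat) \<Rightarrow> (int \<Rightarrow> nat) \<Rightarrow> int \<Rightarrow> letter"
  where "F_map z a n =
    (if z n = 1 then Alpha (a (gamma_idx z n)) else Beta (a (gamma_idx z (eps_idx z n))))"

definition uniform_product :: "nat set \<Rightarrow> (int \<Rightarrow> nat) measure"
  where "uniform_product A = (\<Pi>\<^sub>M i\<in>UNIV. uniform_count_measure A)"

text \<open>Borel sets on the shift space: \<^typ>\<open>letter\<close> is discrete, functions carry the product
  topology, and \<^const>\<open>restrict_space\<close> passes to the subspace.\<close>

definition dyck_measure :: "nat \<Rightarrow> (int \<Rightarrow> letter) measure"
  where "dyck_measure m =
    distr
      (restrict_space (uniform_product {0, 1} \<Otimes>\<^sub>M uniform_product {1..m})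
        (S_minf_minf \<times> (UNIV \<rightarrow> {1..m})))
      (restrict_space borel (dyck_shift m))
      (\<lambda>(z, a). F_map z a)"

definition shift_invariant :: "(int \<Rightarrow> 'a) measure \<Rightarrow> bool"
  where "shift_invariant M \<longleftrightarrow>
    (\<forall>A\<in>sets M. emeasure M (shift -` A \<inter> space M) = emeasure M A)"

end

theory Submission
  imports Defs
begin

text \<open>
  Shifting the height sequence moves the index of each opening bracket by a bijection of the integers
  that depends on \<open>z\<close> only. Hence \<open>F (T z) a = T (F z (a \<circ> \<sigma>\<^sub>z))\<close> for the recurrent sequences
  \<open>z\<close>, and invariance follows from Fubini: the labels are i.i.d. and thus invariant under
  \<open>\<sigma>\<^sub>z\<close>, and the height increments are invariant under the shift.

  Almost every \<open>z\<close> is recurrent because the probability \<open>q k\<close> that the walk started at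
  \<open>k\<close> stays positive is harmonic for \<open>k > 0\<close> and vanishes at \<open>0\<close>; it is therefore linear
  in \<open>k\<close>, and being bounded it is zero.

  The coding map has values in the Dyck shift because the Dyck monoid acts on stacks of labels and
  each letter produced by the map acts successfully on the stack of the brackets open at that time.
\<close>

section \<open>The Dyck monoid acting on stacks\<close>

text \<open>The stacks are infinite, so that a closing bracket fails only by a mismatch.\<close>

fun act_letter :: "letter \<Rightarrow> (nat \<Rightarrow> nat) \<Rightarrow> (nat \<Rightarrow> nat) option"
  where
    "act_letter (Alpha j) s = Some (case_nat j s)"
  | "act_letter (Beta j) s = (if s 0 = j then Some (\<lambda>i. s (Suc i)) else None)"

fun act_word :: "letter list \<Rightarrow> (nat \<Rightarrow> nat) \<Rightarrow> (nat \<Rightarrow> nat) option"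
  where
    "act_word [] s = Some s"
  | "act_word (x # w) s = Option.bind (act_letter x s) (act_word w)"

definition act :: "letter list option \<Rightarrow> (nat \<Rightarrow> nat) \<Rightarrow> (nat \<Rightarrow> nat) option"
  where "act u s = (case u of None \<Rightarrow> None | Some w \<Rightarrow> act_word w s)"

lemma act_word_append: "act_word (u @ v) s = Option.bind (act_word u s) (act_word v)"
  by (induction u s rule: act_word.induct) (auto split: bind_splits)

lemma act_mult0: "act (mult0 u v) = (\<lambda>s. Option.bind (act u s) (act v))"
  by (cases u; cases v) (auto simp: act_def act_word_append split: bind_splits)

text \<open>Partial maps on stacks form a monoid with zero satisfying the relations: pushing
  \<open>j\<close> and popping \<open>j\<close> is the identity, and popping a label other than the
  one just pushed fails on every stack.\<close>

lemma act_dyck_cong: "dyck_cong m u v \<Longrightarrow> act u = act v"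
proof (induction rule: dyck_cong.induct)
  case (mult u u' v v')
  then show ?case by (simp add: act_mult0)
qed (auto simp: act_def)

text \<open>One stack on which \<open>w\<close> succeeds separates \<open>w\<close> from the zero,
  whose action is nowhere defined. This avoids normal forms modulo the congruence.\<close>

lemma dyck_languageI:
  assumes "w \<in> lists (alphabet m)" "act_word w s \<noteq> None"
  shows "w \<in> dyck_language m"
proof -
  have "act (Some w) \<noteq> act None"
    using assms(2) by (auto simp: act_def fun_eq_iff)
  then show ?thesis
    using assms(1) act_dyck_cong by (auto simp: dyck_language_def)
qed

section \<open>Heights\<close>

lemma height_0 [simp]: "height z 0 = 0"
  by (simp add: height_def)

lemma height_step: "height z (i + 1) = height z i + (of_bool (z i = 1) - of_bool (z i = 0))"
proof -
  consider "i \<ge> 0" | "i = -1" | "i < -1" by linarith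
  then show ?thesis
  proof cases
    case 1
    then have "{0..<i + 1} = insert i {0..<i}" by auto
    with 1 show ?thesis by (simp add: height_def)
  next
    case 2
    then show ?thesis by (simp add: height_def)
  next
    case 3
    then have "{i..-1} = insert i {i + 1..-1}" by auto
    with 3 show ?thesis by (simp add: height_def)
  qed
qed

lemma height_shift: "height (shift z) i = height z (i + 1) - height z 1"
proof (induction i rule: int_induct[where k = 0])
  case (step1 i)
  then show ?case
    using height_step[of "shift z" i] height_step[of z "i + 1"]
    by (simp add: shift_def[of z i] add.commute)
next
  case (step2 i)
  then show ?case
    using height_step[of "shift z" "i - 1"] height_step[of z i]
    by (simp add: shift_def[of z "i - 1"])
qed simp

lemma height_nat: "height z (int n) = (\<Sum>i<n. of_bool (z (int i) = 1) - of_bool (z (int i) = 0))"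
proof (induction n)
  case (Suc n)
  then show ?case
    using height_step[of z "int n"] by (simp add: add.commute)
qed simp

lemma height_neg_nat:
  "height z (- int n) = (\<Sum>i<n. of_bool (z (-1 - int i) = 0) - of_bool (z (-1 - int i) = 1))"
proof (induction n)
  case (Suc n)
  then show ?case
    using height_step[of z "-1 - int n"] by (simp add: algebra_simps)
qed simp

text \<open>\<open>eps_idx\<close> at an arbitrary level \<open>v\<close>: the stack of open
  brackets needs the last position at or below each level under the current height.\<close>

definition last_below :: "(int \<Rightarrow> nat) \<Rightarrow> int \<Rightarrow> int \<Rightarrow> int"
  where "last_below z n v = (GREATEST l. l < n \<and> height z l \<le> v)"

lemma eps_idx_eq: "eps_idx z n = last_below z n (height z (n + 1))"
  by (simp add: eps_idx_def last_below_def)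

lemma last_below_Suc_same: "v = height z n \<Longrightarrow> last_below z (n + 1) v = n"
  unfolding last_below_def by (rule Greatest_equality) auto

text \<open>The predicates under \<open>GREATEST\<close> agree, so the values agree even where no
  greatest element exists.\<close>

lemma last_below_Suc_lower:
  assumes "v < height z n"
  shows "last_below z (n + 1) v = last_below z n v"
proof -
  have "l < n + 1 \<and> height z l \<le> v \<longleftrightarrow> l < n \<and> height z l \<le> v" for l
    using assms by (cases "l = n") auto
  then show ?thesis by (simp add: last_below_def)
qed

section \<open>The values of the coding map\<close>

text \<open>The labels of the brackets still open just before position \<open>n\<close>, innermost first.\<close>

definition open_labels :: "(int \<Rightarrow> nat) \<Rightarrow> (int \<Rightarrow> nat) \<Rightarrow> int \<Rightarrow> nat \<Rightarrow> nat"
  where "open_labels z a n i = a (gamma_idx z (last_below z n (height z n - 1 - int i)))"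

text \<open>Entry \<open>i\<close> belongs to the level \<open>height z n - 1 - i\<close>. An
  opening bracket raises the height: position \<open>n\<close> supplies the new entry 0 and the old
  entries move down by one. A closing bracket lowers it and removes entry 0, whose position is
  \<open>eps_idx z n\<close>.\<close>

lemma act_letter_F_map:
  assumes "z \<in> UNIV \<rightarrow> {0, 1}"
  shows "act_letter (F_map z a n) (open_labels z a n) = Some (open_labels z a (n + 1))"
proof (cases "z n = 1")
  case True
  then have h: "height z (n + 1) = height z n + 1"
    by (simp add: height_step)
  have "open_labels z a (n + 1) i = case_nat (a (gamma_idx z n)) (open_labels z a n) i" for i
    by (cases i)
      (simp_all add: open_labels_def h last_below_Suc_same last_below_Suc_lower diff_diff_eq)
  with True show ?thesis by (auto simp: F_map_def)
next
  case False
  with assms have "z n = 0" by (auto simp: Pi_iff)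
  then have h: "height z (n + 1) = height z n - 1"
    by (simp add: height_step)
  have "open_labels z a (n + 1) i = open_labels z a n (Suc i)" for i
    by (simp add: open_labels_def h last_below_Suc_lower diff_diff_eq)
  moreover have "open_labels z a n 0 = a (gamma_idx z (eps_idx z n))"
    by (simp add: open_labels_def eps_idx_eq h)
  ultimately show ?thesis using False by (auto simp: F_map_def)
qed

lemma act_word_F_map:
  assumes "z \<in> UNIV \<rightarrow> {0, 1}"
  shows "act_word (map (F_map z a) [r..l]) (open_labels z a r) \<noteq> None"
proof (induction r l rule: upto.induct)
  case (1 r l)
  then show ?case
    by (cases "r \<le> l") (simp_all add: upto.simps[of r l] act_letter_F_map[OF assms])
qed

text \<open>Covers every binary \<open>z\<close>: where \<open>eps_idx\<close> is unspecified, the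
  letter and the stack entry use the same value. Hence the coding map can be treated on the whole
  product space.\<close>

lemma F_map_in_dyck_shift:
  assumes "z \<in> UNIV \<rightarrow> {0, 1}" "a \<in> UNIV \<rightarrow> {1..m}"
  shows "F_map z a \<in> dyck_shift m"
proof -
  have "F_map z a n \<in> alphabet m" for n
    using assms(2) by (auto simp: F_map_def alphabet_def Pi_iff)
  moreover from this have "map (F_map z a) [r..l] \<in> dyck_language m" for r l
    using act_word_F_map[OF assms(1)] by (intro dyck_languageI) auto
  ultimately show ?thesis by (auto simp: dyck_shift_def)
qed

lemma shift_in_dyck_shift: "x \<in> dyck_shift m \<Longrightarrow> shift x \<in> dyck_shift m"
proof -
  have "map (shift x) [r..l] = map x [r + 1..l + 1]" for r l
    by (rule nth_equalityI) (auto simp: shift_def algebra_simps)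
  then show "x \<in> dyck_shift m \<Longrightarrow> shift x \<in> dyck_shift m"
    by (auto simp: dyck_shift_def Pi_iff shift_def)
qed

section \<open>Equivariance of the coding map\<close>

text \<open>Initial segments are finite, so values that are arbitrarily low at nonnegative arguments
  also occur arbitrarily late.\<close>

lemma Liminf_at_top_int_eq_minf_iff:
  fixes f :: "int \<Rightarrow> int"
  shows "Liminf at_top (\<lambda>n. ereal (of_int (f n))) = -\<infinity> \<longleftrightarrow> (\<forall>K. \<exists>n::nat. f (int n) \<le> K)"
    (is "?L = _ \<longleftrightarrow> ?R")
proof
  assume L: "?L = -\<infinity>"
  show ?R
  proof (rule ccontr)
    assume "\<not> ?R"
    then obtain K where K: "\<And>n::nat. f (int n) > K" by (auto simp: not_le)
    have "ereal (of_int K) \<le> ?L"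
    proof (rule Liminf_bounded)
      show "\<forall>\<^sub>F n in at_top. ereal (of_int K) \<le> ereal (of_int (f n))"
        unfolding eventually_at_top_linorder
      proof (intro exI[of _ 0] allI impI)
        fix n :: int assume "n \<ge> 0"
        then show "ereal (of_int K) \<le> ereal (of_int (f n))"
          using K[of "nat n"] by simp
      qed
    qed
    with L show False by simp
  qed
next
  assume R: ?R
  show "?L = -\<infinity>"
  proof (rule ccontr)
    assume "?L \<noteq> -\<infinity>"
    then obtain C :: real where C: "ereal C < ?L"
      using ereal_dense2[of "-\<infinity>" ?L] by (auto simp: less_top)
    then obtain N where N: "\<And>n. n \<ge> N \<Longrightarrow> C < of_int (f n)"
      using less_LiminfD[OF C] unfolding eventually_at_top_linorder by auto
    \<comment> \<open>Below \<open>C\<close> and below all values on \<open>{0..N}\<close>, so no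
      nonnegative argument has a value this low; inserting 0 keeps \<open>Min\<close> meaningful for
      negative \<open>N\<close>.\<close>
    define K where "K = min \<lfloor>C\<rfloor> (Min (insert 0 (f ` {0..N}))) - 1"
    obtain n :: nat where n: "f (int n) \<le> K" using R by blast
    show False
    proof (cases "int n \<ge> N")
      case True
      then show False using N[OF True] n unfolding K_def by linarith
    next
      case False
      then have "Min (insert 0 (f ` {0..N})) \<le> f (int n)"
        by (intro Min_le) auto
      then show False using n unfolding K_def by linarith
    qed
  qed
qed

lemma Liminf_at_bot_int_eq_minf_iff:
  fixes f :: "int \<Rightarrow> int"
  shows "Liminf at_bot (\<lambda>n. ereal (of_int (f n))) = -\<infinity> \<longleftrightarrow> (\<forall>K. \<exists>n::nat. f (- int n) \<le> K)"
proof -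
  have mirror: "at_bot = filtermap uminus (at_top :: int filter)"
    unfolding filter_eq_iff eventually_filtermap eventually_at_top_linorder
      eventually_at_bot_linorder by (metis neg_le_iff_le minus_minus)
  have "Liminf at_bot (\<lambda>n. ereal (of_int (f n))) = Liminf at_top (\<lambda>n. ereal (of_int (f (- n))))"
    by (subst mirror, rule Liminf_filtermap_eq) (simp add: inj_def)
  then show ?thesis
    by (simp only: Liminf_at_top_int_eq_minf_iff)
qed

lemma S_minf_minf_iff:
  "z \<in> S_minf_minf \<longleftrightarrow> z \<in> UNIV \<rightarrow> {0, 1} \<and>
     (\<forall>K. \<exists>n::nat. height z (int n) \<le> K) \<and> (\<forall>K. \<exists>n::nat. height z (- int n) \<le> K)"
  by (simp add: S_minf_minf_def Liminf_at_top_int_eq_minf_iff Liminf_at_bot_int_eq_minf_iff)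

text \<open>Candidates exist because the left half of the walk is unbounded below, and
  \<open>n\<close> bounds them above, so the maximum behind \<open>GREATEST\<close> exists.\<close>

lemma last_belowE:
  assumes "z \<in> S_minf_minf"
  obtains l where "last_below z n v = l" "l < n" "height z l \<le> v"
    "\<And>k. k < n \<Longrightarrow> height z k \<le> v \<Longrightarrow> k \<le> l"
proof -
  define P where "P l \<longleftrightarrow> l < n \<and> height z l \<le> v" for l
  have "\<exists>l<n. height z l \<le> v"
  proof (cases "n > 0")
    case True
    obtain k :: nat where "height z (- int k) \<le> v"
      using assms unfolding S_minf_minf_iff by blast
    then show ?thesis using True by (intro exI[of _ "- int k"]) auto
  next
    case False
    \<comment> \<open>Below every height on \<open>{n..0}\<close>, which forces
      \<open>- int k\<close> to the left of \<open>n\<close>.\<close>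
    define K where "K = min v (Min (height z ` {n..0})) - 1"
    obtain k :: nat where k: "height z (- int k) \<le> K"
      using assms unfolding S_minf_minf_iff by blast
    have "- int k < n"
    proof (rule ccontr)
      assume "\<not> - int k < n"
      then have "Min (height z ` {n..0}) \<le> height z (- int k)"
        by (intro Min_le) auto
      with k show False unfolding K_def by linarith
    qed
    with k show ?thesis unfolding K_def by (intro exI[of _ "- int k"]) auto
  qed
  then obtain l0 where l0: "P l0" by (auto simp: P_def)
  define A where "A = {l. l0 \<le> l \<and> P l}"
  have A: "finite A" "A \<noteq> {}"
    using l0 by (auto simp: A_def P_def intro: finite_subset[of _ "{l0..n}"])
  define l where "l = Max A"
  have "P l" using Max_in[OF A] by (simp add: l_def A_def)
  moreover have max: "k \<le> l" if "P k" for k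
  proof (cases "l0 \<le> k")
    case True
    then show ?thesis using Max_ge[OF A(1)] that by (simp add: A_def l_def)
  next
    case False
    then show ?thesis using Max_ge[OF A(1)] l0 unfolding l_def A_def
      by (metis (mono_tags, lifting) dual_order.trans linorder_le_cases mem_Collect_eq order_refl)
  qed
  moreover have "(GREATEST l. P l) = l"
    by (rule Greatest_equality) (use \<open>P l\<close> max in auto)
  ultimately show ?thesis
    by (intro that[of l]) (auto simp: last_below_def P_def)
qed

definition source :: "(int \<Rightarrow> nat) \<Rightarrow> int \<Rightarrow> int"
  where "source z n = (if z n = 1 then n else eps_idx z n)"

lemma F_map_source:
  "F_map z a n = (if z n = 1 then Alpha else Beta) (a (gamma_idx z (source z n)))"
  by (simp add: F_map_def source_def)

text \<open>The heights of \<open>shift z\<close> are translated and changed by a constant, so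
  comparisons survive; recurrence supplies the maximum to transport.\<close>

lemma source_shift:
  assumes "z \<in> S_minf_minf"
  shows "source (shift z) n = source z (n + 1) - 1"
proof -
  obtain l where l: "last_below z (n + 1) (height z (n + 2)) = l" "l < n + 1"
    "height z l \<le> height z (n + 2)"
    "\<And>k. k < n + 1 \<Longrightarrow> height z k \<le> height z (n + 2) \<Longrightarrow> k \<le> l"
    using last_belowE[OF assms] by blast
  have "eps_idx (shift z) n = l - 1"
    unfolding eps_idx_def
  proof (rule Greatest_equality)
    fix k assume "k < n \<and> height (shift z) k \<le> height (shift z) (n + 1)"
    then have "k + 1 \<le> l" by (intro l(4)) (auto simp: height_shift add.assoc)
    then show "k \<le> l - 1" by simp
  qed (use l(2,3) in \<open>auto simp: height_shift add.assoc\<close>)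
  moreover have "eps_idx z (n + 1) = l"
    using l(1) by (simp add: eps_idx_eq add.assoc)
  ultimately show ?thesis by (simp add: source_def shift_def)
qed

lemma source_open:
  assumes "z \<in> S_minf_minf"
  shows "z (source z n) = 1"
proof (cases "z n = 1")
  case False
  have zval: "z k = 0 \<or> z k = 1" for k
    using assms by (auto simp: S_minf_minf_iff Pi_iff)
  with False have "z n = 0" by blast
  then have h: "height z (n + 1) = height z n - 1"
    by (simp add: height_step)
  obtain l where l: "last_below z n (height z (n + 1)) = l" "l < n"
    "height z l \<le> height z (n + 1)"
    "\<And>k. k < n \<Longrightarrow> height z k \<le> height z (n + 1) \<Longrightarrow> k \<le> l"
    using last_belowE[OF assms] by blast
  \<comment> \<open>The step out of \<open>l\<close> must go up: \<open>l + 1\<close> is either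
    \<open>n\<close>, one unit above the closing level, or a position before \<open>n\<close> that
    lies above this level by maximality of \<open>l\<close>.\<close>
  have "height z (l + 1) > height z (n + 1)"
  proof (cases "l + 1 = n")
    case True
    then show ?thesis using h by simp
  next
    case False
    then show ?thesis using l(2) l(4)[of "l + 1"] by force
  qed
  then have "z l = 1"
    using l(3) zval[of l] height_step[of z l] by auto
  then show ?thesis using False l(1) by (simp add: source_def eps_idx_eq)
qed (simp add: source_def)

text \<open>For an opening bracket \<open>gamma_idx\<close> counts that bracket itself on either side of the origin,
  so the index \<open>0\<close> labels no opening bracket; shifting past an opening bracket moves its index
  from \<open>1\<close> to \<open>-1\<close>.\<close>

definition relabel :: "(int \<Rightarrow> nat) \<Rightarrow> int \<Rightarrow> int"
  where "relabel z i = (if z 0 \<noteq> 1 \<or> i = 0 then i else if i = 1 then -1 else i - 1)"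

text \<open>For \<open>z 0 = 1\<close> the indices above 1 and the negative ones move down by one;
  this frees -1, which receives 1.\<close>

lemma bij_relabel: "bij (relabel z)"
proof (rule o_bij)
  define r where "r i = (if z 0 \<noteq> 1 \<or> i = 0 then i else if i = -1 then 1 else i + 1)" for i :: int
  show "r \<circ> relabel z = id" "relabel z \<circ> r = id"
    by (auto simp: fun_eq_iff r_def relabel_def)
qed

text \<open>An opening bracket at 0 crosses the origin: indices to its right stop counting it,
  indices to its left start counting it with a minus sign, and its own index passes from 1 to
  -1.\<close>

lemma gamma_idx_shift:
  assumes z: "z \<in> UNIV \<rightarrow> {0, 1}" and k: "z k = 1"
  shows "gamma_idx (shift z) (k - 1) = relabel z (gamma_idx z k)"
proof -
  have z0: "z 0 = 0 \<or> z 0 = 1" using z by (auto simp: Pi_iff)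
  have shift_sum: "(\<Sum>i\<in>{p - 1..q - 1}. int (shift z i)) = (\<Sum>i\<in>{p..q}. int (z i))" for p q
    by (rule sum.reindex_bij_witness[of _ "\<lambda>i. i - 1" "\<lambda>i. i + 1"]) (auto simp: shift_def)
  consider "k > 0" | "k = 0" | "k < 0" by linarith
  then show ?thesis
  proof cases
    case 1
    have "{0..k} = insert 0 {1..k}" "{1..k} = insert k {1..<k}" using 1 by auto
    then have "gamma_idx z k = int (z 0) + gamma_idx (shift z) (k - 1)"
      "gamma_idx (shift z) (k - 1) \<ge> 1"
      using 1 k shift_sum[of 1 k] by (simp_all add: gamma_idx_def sum_nonneg)
    then show ?thesis using z0 by (auto simp: relabel_def)
  next
    case 2
    then show ?thesis using k by (simp add: gamma_idx_def relabel_def shift_def)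
  next
    case 3
    have "{k..0} = insert 0 {k..-1}" "{k..-1} = insert k {k + 1..-1}" using 3 by auto
    then have "gamma_idx (shift z) (k - 1) = gamma_idx z k - int (z 0)" "gamma_idx z k \<le> -1"
      using 3 k shift_sum[of k 0] by (simp_all add: gamma_idx_def sum_nonneg)
    then show ?thesis using z0 by (auto simp: relabel_def)
  qed
qed

text \<open>Letters keep their kind and sources move along with the shift, so only the label indices
  change, by a permutation depending on \<open>z\<close> alone.\<close>

lemma F_map_shift:
  assumes "z \<in> S_minf_minf"
  shows "F_map (shift z) a = shift (F_map z (a \<circ> relabel z))"
proof
  fix n
  have "gamma_idx (shift z) (source z (n + 1) - 1) = relabel z (gamma_idx z (source z (n + 1)))"
    using assms by (intro gamma_idx_shift source_open) (simp_all add: S_minf_minf_iff)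
  then show "F_map (shift z) a n = shift (F_map z (a \<circ> relabel z)) n"
    by (simp add: F_map_source source_shift[OF assms]) (simp add: shift_def F_map_source)
qed

section \<open>Recurrence of the simple random walk\<close>

lemma space_uniform_product: "space (uniform_product A) = UNIV \<rightarrow> A"
  by (simp add: uniform_product_def space_PiM space_uniform_count_measure PiE_UNIV_domain Pi_def)

lemma prob_space_uniform_product:
  assumes "finite A" "A \<noteq> {}"
  shows "prob_space (uniform_product A)"
  unfolding uniform_product_def by (intro prob_space_PiM prob_space_uniform_count_measure assms)

text \<open>Coordinates of an i.i.d. family picked injectively are again i.i.d.; this serves the
  shift, the relabelling and the passage to one-sided walks.\<close>

lemma distr_uniform_product_reindex:
  assumes "finite A" "A \<noteq> {}" "inj f"
  shows "distr (uniform_product A) (\<Pi>\<^sub>M i\<in>UNIV. uniform_count_measure A) (\<lambda>\<omega> i. \<omega> (f i)) =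
    (\<Pi>\<^sub>M i\<in>UNIV. uniform_count_measure A)"
  using distr_PiM_reindex[of UNIV "\<lambda>_. uniform_count_measure A" f UNIV] assms
  by (simp add: uniform_product_def prob_space_uniform_count_measure restrict_UNIV)

lemma measurable_reindex_uniform_product:
  "(\<lambda>\<omega> i. \<omega> (f i)) \<in> uniform_product A \<rightarrow>\<^sub>M (\<Pi>\<^sub>M i\<in>UNIV. uniform_count_measure A)"
  unfolding uniform_product_def
  by (rule measurable_PiM_single') (auto simp: space_PiM PiE_iff extensional_def)

lemma walk_hits_nonpos:
  fixes f :: "nat \<Rightarrow> int" and k :: int
  assumes f: "f 0 = 1 \<and> f 1 = -1 \<or> f 0 = -1 \<and> f 1 = 1"
  shows "AE \<omega> in (\<Pi>\<^sub>M i\<in>UNIV. uniform_count_measure {0, 1}).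
    \<exists>n::nat. k + (\<Sum>i<n. f (\<omega> i)) \<le> 0"
proof -
  define U where "U = uniform_count_measure {0, 1::nat}"
  define S where "S = (\<Pi>\<^sub>M i\<in>(UNIV::nat set). U)"
  have prob_U: "prob_space U"
    unfolding U_def by (rule prob_space_uniform_count_measure) auto
  interpret sequence_space U
    unfolding sequence_space_def product_prob_space_def product_prob_space_axioms_def
      product_sigma_finite_def
    using prob_U by (auto simp: prob_space_imp_sigma_finite)
  interpret SP: prob_space S
    unfolding S_def using prob_U by (intro prob_space_PiM)
  define A where "A k = {\<omega> \<in> space S. \<forall>n. 0 < k + (\<Sum>i<n. f (\<omega> i))}" for k
  have coord [measurable]: "(\<lambda>\<omega>. real_of_int (f (\<omega> i))) \<in> borel_measurable S" for i
  proof -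
    have "(\<lambda>\<omega>. \<omega> i) \<in> S \<rightarrow>\<^sub>M U" unfolding S_def by measurable
    moreover have "(\<lambda>x. real_of_int (f x)) \<in> borel_measurable U"
      unfolding U_def
      by (auto simp: measurable_def sets_uniform_count_measure space_uniform_count_measure)
    ultimately show ?thesis by (rule measurable_compose)
  qed
  have A_alt: "A k = {\<omega> \<in> space S. \<forall>n. 0 < real_of_int k + (\<Sum>i<n. real_of_int (f (\<omega> i)))}" for k
    by (simp only: A_def of_int_sum[symmetric] of_int_add[symmetric] of_int_0_less_iff)
  have A [measurable]: "A k \<in> sets S" for k
    unfolding A_alt by measurable
  \<comment> \<open>Condition on the first step: \<open>PiM_iter\<close> presents the sequence
    measure as the law of an independent fair bit put in front of a sequence. The constraint at time
    0 is \<open>k > 0\<close>.\<close>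
  have A_step: "emeasure S (A k) = (emeasure S (A (k + f 0)) + emeasure S (A (k + f 1))) / 2"
    if "k > 0" for k
  proof -
    let ?g = "\<lambda>(s, \<omega>). case_nat s \<omega>"
    have half: "ennreal (1 / 2) = inverse 2"
      using inverse_ennreal[of 2] by (simp add: inverse_eq_divide)
    have g: "?g \<in> U \<Otimes>\<^sub>M S \<rightarrow>\<^sub>M S" unfolding S_def by measurable
    have mem: "case_nat s \<omega> \<in> A k \<longleftrightarrow> \<omega> \<in> A (k + f s)" if "s \<in> {0, 1}" "\<omega> \<in> space S" for s \<omega>
    proof -
      have all_nat: "(\<forall>n. P n) \<longleftrightarrow> P 0 \<and> (\<forall>n. P (Suc n))" for P :: "nat \<Rightarrow> bool"
        by (metis nat.exhaust)
      have "(\<Sum>i<Suc n. f (case_nat s \<omega> i)) = f s + (\<Sum>i<n. f (\<omega> i))" for n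
        by (simp add: sum.lessThan_Suc_shift del: sum.lessThan_Suc)
      then have "(\<forall>n. 0 < k + (\<Sum>i<n. f (case_nat s \<omega> i))) \<longleftrightarrow> (\<forall>n. 0 < k + f s + (\<Sum>i<n. f (\<omega> i)))"
        using \<open>k > 0\<close> by (subst all_nat) (simp add: add.assoc del: sum.lessThan_Suc)
      moreover have "case_nat s \<omega> \<in> space S"
        using that by (auto simp: S_def U_def space_PiM space_uniform_count_measure PiE_iff
            split: nat.split)
      ultimately show ?thesis using that by (simp add: A_def)
    qed
    have "emeasure S (A k) = emeasure (distr (U \<Otimes>\<^sub>M S) S ?g) (A k)"
      using PiM_iter by (simp add: S_def)
    also have "\<dots> = emeasure (U \<Otimes>\<^sub>M S) (?g -` A k \<inter> space (U \<Otimes>\<^sub>M S))"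
      by (rule emeasure_distr[OF g A])
    also have "\<dots> = (\<integral>\<^sup>+s. emeasure S (Pair s -` (?g -` A k \<inter> space (U \<Otimes>\<^sub>M S))) \<partial>U)"
      by (rule SP.emeasure_pair_measure_alt) (rule measurable_sets[OF g A])
    also have "\<dots> = (\<integral>\<^sup>+s. emeasure S (A (k + f s)) \<partial>U)"
    proof (rule nn_integral_cong)
      fix s assume s: "s \<in> space U"
      then have "Pair s -` (?g -` A k \<inter> space (U \<Otimes>\<^sub>M S)) = A (k + f s)"
        using mem[of s] by (auto simp: U_def space_uniform_count_measure space_pair_measure A_def)
      then show "emeasure S (Pair s -` (?g -` A k \<inter> space (U \<Otimes>\<^sub>M S))) = emeasure S (A (k + f s))"
        by simp
    qed
    also have "\<dots> = (\<Sum>s\<in>{0, 1}. emeasure S (A (k + f s)) * ennreal (1 / 2))"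
      unfolding U_def uniform_count_measure_def
      by (subst nn_integral_point_measure_finite) (simp_all add: mult.commute)
    also have "\<dots> = (emeasure S (A (k + f 0)) + emeasure S (A (k + f 1))) / 2"
      by (simp add: half divide_ennreal_def distrib_right)
    finally show ?thesis .
  qed
  define q where "q k = measure S (A k)" for k
  have q_step: "q k = (q (k - 1) + q (k + 1)) / 2" if "k > 0" for k
  proof -
    have "ennreal (q k) = (ennreal (q (k - 1)) + ennreal (q (k + 1))) / 2"
      using A_step[OF that] f by (auto simp: q_def SP.emeasure_eq_measure add.commute)
    also have "\<dots> = ennreal ((q (k - 1) + q (k + 1)) / 2)"
      by (simp add: q_def ennreal_plus[symmetric] divide_ennreal[symmetric] del: ennreal_plus)
    finally show ?thesis by (simp add: q_def)
  qed
  have q_nonpos: "q k = 0" if "k \<le> 0" for k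
  proof -
    have "A k = {}" using that by (auto simp: A_def intro!: exI[of _ "0::nat"])
    then show ?thesis by (simp add: q_def)
  qed
  \<comment> \<open>The recursion has order two, so two consecutive values are carried along; as
    \<open>q 0 = 0\<close>, only the slope \<open>q 1\<close> remains free.\<close>
  have q_linear: "q (int n) = real n * q 1 \<and> q (int n + 1) = real (n + 1) * q 1" for n
  proof (induction n)
    case (Suc n)
    then show ?case using q_step[of "int n + 1"] by (simp add: algebra_simps)
  qed (simp add: q_nonpos)
  have "q 1 = 0"
  proof (rule ccontr)
    assume "q 1 \<noteq> 0"
    then have "q 1 > 0" by (simp add: q_def zero_less_measure_iff)
    then obtain n :: nat where "1 < real n * q 1" using reals_Archimedean3 by blast
    moreover have "q (int n) \<le> 1" by (simp add: q_def)
    ultimately show False using q_linear[of n] by simp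
  qed
  then have "q k = 0"
    using q_linear[of "nat k"] q_nonpos[of k] by (cases "k \<le> 0") auto
  then have "A k \<in> null_sets S"
    by (simp add: q_def SP.emeasure_eq_measure null_sets_def)
  then have "AE \<omega> in S. \<exists>n::nat. k + (\<Sum>i<n. f (\<omega> i)) \<le> 0"
    by (rule AE_I') (auto simp: A_def not_le)
  then show ?thesis unfolding S_def U_def .
qed

text \<open>Reaching \<open>K\<close> from 0 means reaching a nonpositive value from
  \<open>- K\<close>, and there are countably many \<open>K\<close>. The injection \<open>g\<close>
  serves to select one half of the two-sided sequence.\<close>

lemma AE_walk_unbounded:
  fixes f :: "nat \<Rightarrow> int" and g :: "nat \<Rightarrow> int"
  assumes f: "f 0 = 1 \<and> f 1 = -1 \<or> f 0 = -1 \<and> f 1 = 1" and g: "inj g"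
  shows "AE z in uniform_product {0, 1}. \<forall>K. \<exists>n::nat. (\<Sum>i<n. f (z (g i))) \<le> K"
  unfolding AE_all_countable
proof
  fix K :: int
  have "AE \<omega> in distr (uniform_product {0, 1}) (\<Pi>\<^sub>M i\<in>UNIV. uniform_count_measure {0, 1}) (\<lambda>z i. z (g i)).
    \<exists>n::nat. - K + (\<Sum>i<n. f (\<omega> i)) \<le> 0"
    by (subst distr_uniform_product_reindex[OF _ _ g]) (rule walk_hits_nonpos[OF f] | simp)+
  from AE_distrD[OF measurable_reindex_uniform_product this]
  show "AE z in uniform_product {0, 1}. \<exists>n::nat. (\<Sum>i<n. f (z (g i))) \<le> K"
    by simp
qed

lemma AE_S_minf_minf: "AE z in uniform_product {0, 1}. z \<in> S_minf_minf"
proof -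
  have "AE z in uniform_product {0, 1}. \<forall>K. \<exists>n::nat. height z (int n) \<le> K"
    unfolding height_nat
    by (rule AE_walk_unbounded[of "\<lambda>x. of_bool (x = 1) - of_bool (x = 0)" int]) (auto simp: inj_def)
  moreover have "AE z in uniform_product {0, 1}. \<forall>K. \<exists>n::nat. height z (- int n) \<le> K"
    unfolding height_neg_nat
    by (rule AE_walk_unbounded[of "\<lambda>x. of_bool (x = 0) - of_bool (x = 1)" "\<lambda>i. -1 - int i"])
      (auto simp: inj_def)
  ultimately show ?thesis
    using AE_space
    by eventually_elim (simp add: S_minf_minf_iff space_uniform_product)
qed

section \<open>Measurability\<close>

instance letter :: countable
  by countable_datatype

text \<open>Ensures that measurability into the Borel sets of the full shift can be checked
  coordinatewise.\<close>

instance letter :: second_countable_topology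
proof
  have "open = generate_topology (range (\<lambda>x::letter. {x}))"
  proof (intro ext iffI)
    fix S :: "letter set"
    have "generate_topology (range (\<lambda>x::letter. {x})) (\<Union>x\<in>S. {x})"
      by (intro generate_topology.UN) (auto intro: generate_topology.Basis)
    then show "generate_topology (range (\<lambda>x::letter. {x})) S" by simp
  qed (auto simp: open_letter_def)
  then show "\<exists>B::letter set set. countable B \<and> open = generate_topology B"
    by (intro exI[of _ "range (\<lambda>x. {x})"]) auto
qed

lemma measurable_uniform_product_coordinate [measurable]:
  "(\<lambda>z. z i) \<in> uniform_product A \<rightarrow>\<^sub>M count_space UNIV"
proof -
  have "(\<lambda>z. z i) \<in> uniform_product A \<rightarrow>\<^sub>M uniform_count_measure A"
    unfolding uniform_product_def by measurable
  moreover have "(\<lambda>x. x) \<in> uniform_count_measure A \<rightarrow>\<^sub>M count_space UNIV"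
    by (simp add: measurable_def sets_uniform_count_measure space_uniform_count_measure)
  ultimately show ?thesis by (rule measurable_compose)
qed

lemma measurable_sum_int:
  fixes f :: "'i \<Rightarrow> 'a \<Rightarrow> int"
  assumes "\<And>i. i \<in> I \<Longrightarrow> f i \<in> M \<rightarrow>\<^sub>M count_space UNIV"
  shows "(\<lambda>x. \<Sum>i\<in>I. f i x) \<in> M \<rightarrow>\<^sub>M count_space UNIV"
  using assms
proof (induction I rule: infinite_finite_induct)
  case (insert i I)
  then have [measurable]: "f i \<in> M \<rightarrow>\<^sub>M count_space UNIV"
    "(\<lambda>x. \<Sum>i\<in>I. f i x) \<in> M \<rightarrow>\<^sub>M count_space UNIV"
    by auto
  have "(\<lambda>x. f i x + (\<Sum>i\<in>I. f i x)) \<in> M \<rightarrow>\<^sub>M count_space UNIV"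
    by measurable
  with insert show ?case by simp
qed auto

lemma measurable_height [measurable]:
  "(\<lambda>z. height z n) \<in> uniform_product A \<rightarrow>\<^sub>M count_space UNIV"
  unfolding height_def by (cases "0 \<le> n") (auto intro!: measurable_sum_int)

lemma measurable_gamma_idx [measurable]:
  "(\<lambda>z. gamma_idx z n) \<in> uniform_product A \<rightarrow>\<^sub>M count_space UNIV"
proof -
  have [measurable]: "(\<lambda>z. \<Sum>i\<in>I. int (z i)) \<in> uniform_product A \<rightarrow>\<^sub>M count_space UNIV" for I
    by (rule measurable_sum_int) measurable
  show ?thesis unfolding gamma_idx_def by (cases "0 \<le> n") simp_all
qed

text \<open>Being the maximum is a countable condition on \<open>z\<close>, and the maximum is
  unique where it exists; elsewhere \<open>THE\<close> is constant.\<close>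

lemma measurable_eps_idx [measurable]:
  "(\<lambda>z. eps_idx z n) \<in> uniform_product A \<rightarrow>\<^sub>M count_space UNIV"
proof -
  define G where "G z l \<longleftrightarrow> (l < n \<and> height z l \<le> height z (n + 1)) \<and>
    (\<forall>k. k < n \<and> height z k \<le> height z (n + 1) \<longrightarrow> k \<le> l)" for z l
  have [measurable]: "Measurable.pred (uniform_product A) (\<lambda>z. G z l)" for l
    unfolding G_def by measurable
  have "(\<lambda>z. eps_idx z n) = (\<lambda>z. THE l. G z l)"
    by (simp add: eps_idx_def Greatest_def G_def)
  also have "\<dots> \<in> uniform_product A \<rightarrow>\<^sub>M count_space UNIV"
    by (rule measurable_THE[where I = UNIV]) (auto simp: G_def intro: order_antisym)
  finally show ?thesis .
qed

lemma measurable_F_map [measurable]: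
  "(\<lambda>(z, a). F_map z a) \<in> borel_measurable (uniform_product A \<Otimes>\<^sub>M uniform_product B)"
proof (rule measurable_coordinatewise_then_product)
  fix n
  have "(\<lambda>x. F_map (fst x) (snd x) n) \<in> uniform_product A \<Otimes>\<^sub>M uniform_product B \<rightarrow>\<^sub>M count_space UNIV"
    unfolding F_map_def by measurable
  then show "(\<lambda>x. (case x of (z, a) \<Rightarrow> F_map z a) n) \<in>
      borel_measurable (uniform_product A \<Otimes>\<^sub>M uniform_product B)"
    by (simp add: case_prod_beta measurable_def)
qed

lemma sets_S_minf_minf: "S_minf_minf \<in> sets (uniform_product {0, 1})"
proof -
  have "S_minf_minf = {z \<in> space (uniform_product {0, 1}).
     (\<forall>K. \<exists>n::nat. height z (int n) \<le> K) \<and> (\<forall>K. \<exists>n::nat. height z (- int n) \<le> K)}"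
    by (rule set_eqI) (simp only: S_minf_minf_iff space_uniform_product mem_Collect_eq)
  also have "\<dots> \<in> sets (uniform_product {0, 1})" by measurable
  finally show ?thesis .
qed

section \<open>Invariance\<close>

lemma F_map_measurable_dyck_shift:
  "(\<lambda>(z, a). F_map z a) \<in> uniform_product {0, 1} \<Otimes>\<^sub>M uniform_product {1..m} \<rightarrow>\<^sub>M
    restrict_space borel (dyck_shift m)"
  by (rule measurable_restrict_space2)
    (auto simp only: space_pair_measure space_uniform_product prod.case
      intro!: F_map_in_dyck_shift measurable_F_map)

lemma shift_measurable_dyck_shift:
  "shift \<in> restrict_space borel (dyck_shift m) \<rightarrow>\<^sub>M restrict_space borel (dyck_shift m)"
proof -
  have "(\<lambda>x n. shift x n) \<in> borel \<rightarrow>\<^sub>M (borel :: (int \<Rightarrow> letter) measure)"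
    unfolding shift_def
    by (rule measurable_coordinatewise_then_product) (rule measurable_product_coordinates)
  then show ?thesis
    by (intro measurable_restrict_space3) (auto intro: shift_in_dyck_shift)
qed

lemma space_dyck_measure: "space (dyck_measure m) = dyck_shift m"
  by (simp add: dyck_measure_def space_restrict_space)

lemma sets_dyck_measure: "sets (dyck_measure m) = sets (restrict_space borel (dyck_shift m))"
  by (simp add: dyck_measure_def)

text \<open>Recurrent sequences have full measure, so restricting the domain of the coding map does
  not change the integral; the rest is Tonelli, slicing along \<open>z\<close>.\<close>

lemma emeasure_dyck_measure:
  assumes "m \<ge> 1" and A: "A \<in> sets (dyck_measure m)"
  shows "emeasure (dyck_measure m) A =
    (\<integral>\<^sup>+z. emeasure (uniform_product {1..m}) {a \<in> space (uniform_product {1..m}). F_map z a \<in> A}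
      \<partial>uniform_product {0, 1})"
proof -
  let ?Z = "uniform_product {0, 1}" and ?B = "uniform_product {1..m}"
  let ?F = "\<lambda>(z, a). F_map z a"
  interpret Z: prob_space ?Z by (rule prob_space_uniform_product) auto
  interpret B: prob_space ?B by (rule prob_space_uniform_product) (use assms in auto)
  let ?E = "?F -` A \<inter> space (?Z \<Otimes>\<^sub>M ?B)"
  let ?D = "S_minf_minf \<times> (UNIV \<rightarrow> {1..m})"
  have A': "A \<in> sets (restrict_space borel (dyck_shift m))"
    using A by (simp add: sets_dyck_measure)
  have E: "?E \<in> sets (?Z \<Otimes>\<^sub>M ?B)"
    by (rule measurable_sets[OF F_map_measurable_dyck_shift A'])
  have D: "?D \<in> sets (?Z \<Otimes>\<^sub>M ?B)"
    using sets_S_minf_minf sets.top[of ?B] by (simp add: space_uniform_product)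
  have "AE x in ?Z \<Otimes>\<^sub>M ?B. fst x \<in> S_minf_minf"
    using AE_S_minf_minf
    by (intro AE_distrD[OF measurable_fst]) (simp only: B.distr_pair_fst)
  then have full: "AE x in ?Z \<Otimes>\<^sub>M ?B. x \<in> ?D"
    using AE_space
    by eventually_elim (auto simp: space_pair_measure space_uniform_product)
  have "emeasure (dyck_measure m) A =
      emeasure (restrict_space (?Z \<Otimes>\<^sub>M ?B) ?D) (?F -` A \<inter> space (restrict_space (?Z \<Otimes>\<^sub>M ?B) ?D))"
    unfolding dyck_measure_def
    by (rule emeasure_distr[OF measurable_restrict_space1[OF F_map_measurable_dyck_shift] A'])
  also have "\<dots> = emeasure (restrict_space (?Z \<Otimes>\<^sub>M ?B) ?D) (?E \<inter> ?D)"
    by (rule arg_cong2[where f = emeasure]) (auto simp: space_restrict_space)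
  also have "\<dots> = emeasure (?Z \<Otimes>\<^sub>M ?B) (?E \<inter> ?D)"
    using D by (intro emeasure_restrict_space) auto
  also have "\<dots> = emeasure (?Z \<Otimes>\<^sub>M ?B) ?E"
    using full D E by (intro emeasure_eq_AE) auto
  also have "\<dots> = (\<integral>\<^sup>+z. emeasure ?B (Pair z -` ?E) \<partial>?Z)"
    by (rule B.emeasure_pair_measure_alt[OF E])
  also have "\<dots> = (\<integral>\<^sup>+z. emeasure ?B {a \<in> space ?B. F_map z a \<in> A} \<partial>?Z)"
    by (intro nn_integral_cong arg_cong2[where f = emeasure]) (auto simp: space_pair_measure)
  finally show ?thesis .
qed

lemma prob_space_dyck_measure:
  assumes "m \<ge> 1"
  shows "prob_space (dyck_measure m)"
proof
  interpret Z: prob_space "uniform_product {0, 1}"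
    by (rule prob_space_uniform_product) auto
  interpret B: prob_space "uniform_product {1..m}"
    by (rule prob_space_uniform_product) (use assms in auto)
  have "emeasure (dyck_measure m) (dyck_shift m) = (\<integral>\<^sup>+z. 1 \<partial>uniform_product {0, 1})"
    unfolding emeasure_dyck_measure[OF assms sets.top[of "dyck_measure m", unfolded space_dyck_measure]]
  proof (rule nn_integral_cong)
    fix z assume "z \<in> space (uniform_product {0, 1})"
    then have "{a \<in> space (uniform_product {1..m}). F_map z a \<in> dyck_shift m} =
        space (uniform_product {1..m})"
      using F_map_in_dyck_shift by (auto simp: space_uniform_product)
    then show "emeasure (uniform_product {1..m})
        {a \<in> space (uniform_product {1..m}). F_map z a \<in> dyck_shift m} = 1"
      by (simp only: B.emeasure_space_1)
  qed
  then show "emeasure (dyck_measure m) (space (dyck_measure m)) = 1"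
    by (simp only: space_dyck_measure nn_integral_const Z.emeasure_space_1 mult_1_left)
qed

lemma shift_invariant_dyck_measure:
  assumes "m \<ge> 1"
  shows "shift_invariant (dyck_measure m)"
  unfolding shift_invariant_def
proof
  fix A assume A: "A \<in> sets (dyck_measure m)"
  let ?Z = "uniform_product {0, 1}" and ?B = "uniform_product {1..m}"
  let ?TA = "shift -` A \<inter> space (dyck_measure m)"
  define h where "h A z = emeasure ?B {a \<in> space ?B. F_map z a \<in> A}" for A z
  interpret B: prob_space ?B
    by (rule prob_space_uniform_product) (use assms in auto)
  have TA: "?TA \<in> sets (dyck_measure m)"
    using measurable_sets[OF shift_measurable_dyck_shift] A
    by (simp add: sets_dyck_measure space_dyck_measure space_restrict_space)
  have F: "(\<lambda>(z, a). F_map z a) \<in> ?Z \<Otimes>\<^sub>M ?B \<rightarrow>\<^sub>M dyck_measure m"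
    using F_map_measurable_dyck_shift
    by (simp add: measurable_cong_sets[OF HOL.refl sets_dyck_measure])
  have slice: "{a \<in> space ?B. F_map z a \<in> A} \<in> sets ?B"
    if "z \<in> space ?Z" "A \<in> sets (dyck_measure m)" for z A
    using measurable_sets[OF measurable_Pair2[OF F that(1)] that(2)]
    by (simp add: vimage_def Int_def conj_commute)
  \<comment> \<open>Prepares the change of variables along \<open>shift\<close> at the end.\<close>
  have h_measurable: "h A \<in> borel_measurable ?Z"
  proof -
    have "(\<lambda>z. emeasure ?B (Pair z -` ((\<lambda>(z, a). F_map z a) -` A \<inter> space (?Z \<Otimes>\<^sub>M ?B))))
        \<in> borel_measurable ?Z"
      by (rule B.measurable_emeasure_Pair) (rule measurable_sets[OF F A])
    also have "?this \<longleftrightarrow> ?thesis"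
      unfolding h_def
      by (intro measurable_cong arg_cong2[where f = emeasure]) (auto simp: space_pair_measure)
    finally show ?thesis .
  qed
  \<comment> \<open>The law of the labels is invariant under the permutation
    \<open>relabel z\<close>, and equivariance turns the preimage of the slice of \<open>?TA\<close>
    at \<open>z\<close> into the slice of \<open>A\<close> at \<open>shift z\<close>.\<close>
  have h_shift: "h ?TA z = h A (shift z)" if z: "z \<in> S_minf_minf" for z
  proof -
    have zsp: "z \<in> space ?Z" using z by (simp add: S_minf_minf_iff space_uniform_product)
    let ?r = "\<lambda>a i. a (relabel z i)"
    have "inj (relabel z)" using bij_relabel by (rule bij_is_inj)
    then have "h ?TA z = emeasure (distr ?B ?B ?r) {a \<in> space ?B. F_map z a \<in> ?TA}"
      using distr_uniform_product_reindex[of "{1..m}" "relabel z"] assms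
      by (simp add: h_def uniform_product_def)
    also have "\<dots> = emeasure ?B (?r -` {a \<in> space ?B. F_map z a \<in> ?TA} \<inter> space ?B)"
      using measurable_reindex_uniform_product[of "relabel z" "{1..m}"] slice[OF zsp TA]
      by (intro emeasure_distr) (simp_all add: uniform_product_def)
    also have "?r -` {a \<in> space ?B. F_map z a \<in> ?TA} \<inter> space ?B =
        {a \<in> space ?B. F_map (shift z) a \<in> A}"
      using z F_map_in_dyck_shift[of z "?r _" m]
      by (auto simp: F_map_shift comp_def space_uniform_product space_dyck_measure S_minf_minf_iff Pi_iff)
    finally show ?thesis by (simp add: h_def)
  qed
  have "emeasure (dyck_measure m) ?TA = (\<integral>\<^sup>+z. h ?TA z \<partial>?Z)"
    unfolding h_def by (rule emeasure_dyck_measure[OF assms TA])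
  \<comment> \<open>Equivariance is available for recurrent \<open>z\<close>, that is, almost
    everywhere.\<close>
  also have "\<dots> = (\<integral>\<^sup>+z. h A (shift z) \<partial>?Z)"
    using AE_S_minf_minf h_shift by (intro nn_integral_cong_AE) auto
  also have "\<dots> = (\<integral>\<^sup>+z. h A z \<partial>distr ?Z ?Z shift)"
    using measurable_reindex_uniform_product[of "\<lambda>i. i + 1" "{0, 1}"] h_measurable
    by (intro nn_integral_distr[symmetric]) (simp_all add: uniform_product_def shift_def[abs_def])
  also have "distr ?Z ?Z shift = ?Z"
    using distr_uniform_product_reindex[of "{0, 1}" "\<lambda>i. i + 1"]
    by (simp add: uniform_product_def shift_def[abs_def] inj_def)
  also have "(\<integral>\<^sup>+z. h A z \<partial>?Z) = emeasure (dyck_measure m) A"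
    unfolding h_def by (rule emeasure_dyck_measure[OF assms A, symmetric])
  finally show "emeasure (dyck_measure m) ?TA = emeasure (dyck_measure m) A" .
qed

theorem proposition3p4:
  fixes m :: nat
  assumes "m \<ge> 2"
  shows "prob_space (dyck_measure m) \<and> shift_invariant (dyck_measure m)"
  using assms prob_space_dyck_measure shift_invariant_dyck_measure by simp

end
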